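(* Consider the latent linear system, the open client–server observations and the source-reliability weighted observer described in the context, with estimation error $\tilde{\mathbf{x}}_{t|t}=\hat{\mathbf{x}}_{t|t}-\mathbf{x}_t$, induced error matrices $\mathbf{F}_t^\omega$, transition products $\mathbf{\Phi}_\omega(t,s)$ and forcing terms $\boldsymbol{\eta}_t$ as defined there. Suppose that: (i) (Post-learning reliability separation) there exist $T_{\rm sep}<\infty$, $\underline{\omega}_{\mathcal{C}}>0$ and $\bar{\omega}_{\mathcal{S}}\ge0$ with $\bar{\omega}_{\mathcal{S}}<\underline{\omega}_{\mathcal{C}}$ such that for all $t\ge T_{\rm sep}$, $$\omega_i(t)\ge\underline{\omega}_{\mathcal{C}}\ \text{ for all } i\in\mathcal{C}\cap\mathcal{A}_t,\qquad \omega_j(t)\le\bar{\omega}_{\mathcal{S}}\ \text{ for all } j\in\mathcal{S}\cap\mathcal{A}_t;$$ (ii) (Post-learning product stability) there exist constants $c_\omega\ge1$ and $\rho_\omega\in(0,1)$ such that, for all $t\ge s\ge T_{\rm sep}$, $$\|\mathbf{\Phi}_\omega(t,s)\|_2\le c_\omega\rho_\omega^{\,t-s+1}.$$ Then, for all $t\ge s\ge T_{\rm sep}$, $$\|\tilde{\mathbf{x}}_{t|t}\|\le c_\omega\rho_\omega^{\,t-s+1}\|\tilde{\mathbf{x}}_{s-1|s-1}\|+c_\omega\sum_{\ell=s}^{t}\rho_\omega^{\,t-\ell}\|\boldsymbol{\eta}_\ell\|.$$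
   Context: Norms: $\|\cdot\|$ is the Euclidean norm on vectors, $\|\cdot\|_2$ the induced spectral norm on matrices, and $\|\mathbf{z}\|_{\mathbf{P}}^2:=\mathbf{z}^\top\mathbf{P}\mathbf{z}$ for symmetric positive semidefinite $\mathbf{P}$. $\mathbf{P}\succ0$ means symmetric positive definite. Time: $t,s,\ell,T_{\rm sep}$ are integers; observations and corrections take place at times $t\ge0$, the initial state and estimate $\mathbf{x}_{-1},\hat{\mathbf{x}}_{-1|-1}\in\mathbb{R}^d$ are given at time $-1$, and $T_{\rm sep}\ge0$. System and sources: the latent state satisfies $\mathbf{x}_{t+1}=\mathbf{A}\mathbf{x}_t+\mathbf{w}_t$, $\mathbf{x}_t\in\mathbb{R}^d$, with known $\mathbf{A}\in\mathbb{R}^{d\times d}$ and process disturbance $\mathbf{w}_t\in\mathbb{R}^d$. The source set is $\mathcal{N}=\{1,\ldots,N\}$, partitioned into a fixed subset $\mathcal{C}\subset\mathcal{N}$ of state-consistent sources and its complement $\mathcal{S}=\mathcal{N}\setminus\mathcal{C}$ of nuisance sources. At time $t$ the set of active sources is $\mathcal{A}_t\subset\mathcal{N}$. Each source $i\in\mathcal{N}$ has a matrix $\mathbf{H}_i\in\mathbb{R}^{m_i\times d}$ and a matrix $\mathbf{R}_i\in\mathbb{R}^{m_i\times m_i}$, $\mathbf{R}_i\succ0$. An active source $i\in\mathcal{C}\cap\mathcal{A}_t$ sends $\mathbf{y}_i(t)=\mathbf{H}_i\mathbf{x}_t+\mathbf{v}_i(t)$ with measurement noise $\mathbf{v}_i(t)\in\mathbb{R}^{m_i}$;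 an active source $j\in\mathcal{S}\cap\mathcal{A}_t$ sends $\mathbf{y}_j(t)=\boldsymbol{\xi}_j(t)$, an arbitrary signal in $\mathbb{R}^{m_j}$. No distributional assumptions are used; statements are for given realizations. Observer: let $\mathbf{\Sigma}\in\mathbb{R}^{d\times d}$, $\mathbf{\Sigma}\succ0$, be fixed and let $\omega_i(t)\in[0,1]$ be the reliability weights of the sources. The observer predicts $\hat{\mathbf{x}}_{t|t-1}=\mathbf{A}\hat{\mathbf{x}}_{t-1|t-1}$ and corrects by $$\hat{\mathbf{x}}_{t|t}=\arg\min_{\mathbf{x}\in\mathbb{R}^d}\Big\{\|\mathbf{x}-\hat{\mathbf{x}}_{t|t-1}\|_{\mathbf{\Sigma}^{-1}}^2+\sum_{i\in\mathcal{A}_t}\omega_i(t)\|\mathbf{y}_i(t)-\mathbf{H}_i\mathbf{x}\|_{\mathbf{R}_i^{-1}}^2\Big\}$$ (this minimizer is unique since $\mathbf{\Sigma}\succ0$). Stacked quantities: for $\mathcal{A}_t=\{i_1,\ldots,i_{a_t}\}$, $\mathbf{y}_t$ and $\mathbf{H}_t$ are the vertical stackings of $\mathbf{y}_{i_1}(t),\ldots,\mathbf{y}_{i_{a_t}}(t)$ and of $\mathbf{H}_{i_1},\ldots,\mathbf{H}_{i_{a_t}}$; $\mathbf{W}_t^\omega$ is block diagonal with blocks $\omega_{i_1}(t)\mathbf{R}_{i_1}^{-1},\ldots,\omega_{i_{a_t}}(t)\mathbf{R}_{i_{a_t}}^{-1}$; $\mathbf{d}_t:=\mathbf{y}_t-\mathbf{H}_t\mathbf{x}_t$,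 i.e. $\mathbf{d}_t$ stacks the noises $\mathbf{v}_i(t)$ for $i\in\mathcal{C}\cap\mathcal{A}_t$ and the mismatch terms $\boldsymbol{\xi}_j(t)-\mathbf{H}_j\mathbf{x}_t$ for $j\in\mathcal{S}\cap\mathcal{A}_t$. Set $$\mathbf{S}_t^\omega:=\mathbf{\Sigma}^{-1}+\mathbf{H}_t^\top\mathbf{W}_t^\omega\mathbf{H}_t,\qquad \mathbf{K}_t^\omega:=(\mathbf{S}_t^\omega)^{-1}\mathbf{H}_t^\top\mathbf{W}_t^\omega .$$ If $\mathcal{A}_t=\emptyset$, all measurement terms (including $\mathbf{K}_t^\omega\mathbf{H}_t$ and $\mathbf{K}_t^\omega\mathbf{d}_t$) are zero. Error quantities: $\tilde{\mathbf{x}}_{t|t}:=\hat{\mathbf{x}}_{t|t}-\mathbf{x}_t$, $$\mathbf{F}_t^\omega:=(\mathbf{I}-\mathbf{K}_t^\omega\mathbf{H}_t)\mathbf{A},\qquad \boldsymbol{\eta}_t:=-(\mathbf{I}-\mathbf{K}_t^\omega\mathbf{H}_t)\mathbf{w}_{t-1}+\mathbf{K}_t^\omega\mathbf{d}_t,$$ and for $t\ge s$, $\mathbf{\Phi}_\omega(t,s):=\mathbf{F}_t^\omega\mathbf{F}_{t-1}^\omega\cdots\mathbf{F}_s^\omega$, with the empty-product convention $\mathbf{\Phi}_\omega(t,t+1)=\mathbf{I}$. *)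

theory Defs
  imports Complex_Main "Jordan_Normal_Form.Gauss_Jordan_Elimination"
begin

definition vnorm :: "real vec \<Rightarrow> real" where
  "vnorm v = sqrt (v \<bullet> v)"

definition spectral_norm :: "real mat \<Rightarrow> real" where
  "spectral_norm M = Sup {vnorm (M *\<^sub>v v) | v. v \<in> carrier_vec (dim_col M) \<and> vnorm v \<le> 1}"

definition wnorm_sq :: "real mat \<Rightarrow> real vec \<Rightarrow> real" where
  "wnorm_sq P z = z \<bullet> (P *\<^sub>v z)"

definition pos_def_mat :: "nat \<Rightarrow> real mat \<Rightarrow> bool" where
  "pos_def_mat n M \<longleftrightarrow> M \<in> carrier_mat n n \<and> M\<^sup>T = M \<and>
     (\<forall>v \<in> carrier_vec n. v \<noteq> 0\<^sub>v n \<longrightarrow> v \<bullet> (M *\<^sub>v v) > 0)"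

(* Meaningful for invertible matrices only; unspecified otherwise. *)
definition inv_mat :: "real mat \<Rightarrow> real mat" where
  "inv_mat M = the (mat_inverse M)"

(* In the definitions below, J is the finite set of sources active at one time and \<omega>, y are the
   weights and messages at that time. All stackings list J in increasing order. For J = {} the
   stacked objects have zero rows, so that every product with the gain is a zero matrix or vector. *)

definition stack_vec :: "(nat \<Rightarrow> real vec) \<Rightarrow> nat set \<Rightarrow> real vec" where
  "stack_vec y J = foldr (\<lambda>i v. y i @\<^sub>v v) (sorted_list_of_set J) (0\<^sub>v 0)"

definition stack_mat :: "nat \<Rightarrow> (nat \<Rightarrow> real mat) \<Rightarrow> nat set \<Rightarrow> real mat" where
  "stack_mat d H J = foldr (\<lambda>i M. H i @\<^sub>r M) (sorted_list_of_set J) (0\<^sub>m 0 d)"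

definition weight_mat :: "(nat \<Rightarrow> real mat) \<Rightarrow> (nat \<Rightarrow> real) \<Rightarrow> nat set \<Rightarrow> real mat" where
  "weight_mat R \<omega> J = diag_block_mat (map (\<lambda>i. \<omega> i \<cdot>\<^sub>m inv_mat (R i)) (sorted_list_of_set J))"

definition info_mat ::
  "nat \<Rightarrow> real mat \<Rightarrow> (nat \<Rightarrow> real mat) \<Rightarrow> (nat \<Rightarrow> real mat) \<Rightarrow> (nat \<Rightarrow> real) \<Rightarrow> nat set \<Rightarrow> real mat" where
  "info_mat d Sig H R \<omega> J =
     inv_mat Sig + (stack_mat d H J)\<^sup>T * weight_mat R \<omega> J * stack_mat d H J"

definition gain_mat ::
  "nat \<Rightarrow> real mat \<Rightarrow> (nat \<Rightarrow> real mat) \<Rightarrow> (nat \<Rightarrow> real mat) \<Rightarrow> (nat \<Rightarrow> real) \<Rightarrow> nat set \<Rightarrow> real mat" where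
  "gain_mat d Sig H R \<omega> J =
     inv_mat (info_mat d Sig H R \<omega> J) * (stack_mat d H J)\<^sup>T * weight_mat R \<omega> J"

definition error_mat ::
  "nat \<Rightarrow> real mat \<Rightarrow> real mat \<Rightarrow> (nat \<Rightarrow> real mat) \<Rightarrow> (nat \<Rightarrow> real mat) \<Rightarrow> (nat \<Rightarrow> real) \<Rightarrow> nat set
    \<Rightarrow> real mat" where
  "error_mat d A Sig H R \<omega> J = (1\<^sub>m d - gain_mat d Sig H R \<omega> J * stack_mat d H J) * A"

(* x is the state at the current time, w the disturbance at the preceding time. *)
definition forcing ::
  "nat \<Rightarrow> real mat \<Rightarrow> (nat \<Rightarrow> real mat) \<Rightarrow> (nat \<Rightarrow> real mat) \<Rightarrow> (nat \<Rightarrow> real) \<Rightarrow> nat set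
    \<Rightarrow> (nat \<Rightarrow> real vec) \<Rightarrow> real vec \<Rightarrow> real vec \<Rightarrow> real vec" where
  "forcing d Sig H R \<omega> J y x w =
     - ((1\<^sub>m d - gain_mat d Sig H R \<omega> J * stack_mat d H J) *\<^sub>v w)
     + gain_mat d Sig H R \<omega> J *\<^sub>v (stack_vec y J - stack_mat d H J *\<^sub>v x)"

(* F t * F (t - 1) * ... * F s, and the identity if t < s *)
definition transition :: "nat \<Rightarrow> (int \<Rightarrow> real mat) \<Rightarrow> int \<Rightarrow> int \<Rightarrow> real mat" where
  "transition d F t s = fold (\<lambda>l M. F l * M) [s..t] (1\<^sub>m d)"

definition correction_cost ::
  "real mat \<Rightarrow> (nat \<Rightarrow> real mat) \<Rightarrow> (nat \<Rightarrow> real mat) \<Rightarrow> (nat \<Rightarrow> real) \<Rightarrow> nat set \<Rightarrow> (nat \<Rightarrow> real vec)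
    \<Rightarrow> real vec \<Rightarrow> real vec \<Rightarrow> real" where
  "correction_cost Sig H R \<omega> J y p z =
     wnorm_sq (inv_mat Sig) (z - p) + (\<Sum>i\<in>J. \<omega> i * wnorm_sq (inv_mat (R i)) (y i - H i *\<^sub>v z))"

end

theory Submission
  imports Defs "Jordan_Normal_Form.Determinant" "HOL-Analysis.L2_Norm"
begin

text \<open>
  Completing the square shows that the corrected estimate is the prediction plus the gain applied
  to the innovation. Hence the error obeys the affine recursion with matrix \<open>F t\<close> and
  input \<open>\<eta> t\<close>. Unrolling it backwards from \<open>t\<close>, each input \<open>\<eta> l\<close> reaches time
  \<open>t\<close> through \<open>\<Phi>(t, l + 1)\<close>, whose norm is controlled by the product stability; for
  \<open>l = t\<close> this is the identity and \<open>c \<ge> 1\<close> suffices.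
\<close>

section \<open>Norms\<close>

text \<open>A single factor is only known to be bounded by \<open>c * \<rho>\<close>, so iterating
  the one-step estimate would cost another factor \<open>c\<close> at each step. Keeping the final
  time \<open>t\<close> fixed and bounding only whole products that end at \<open>t\<close> makes
  \<open>c\<close> appear once per term of the sum.

  The correction is given as a minimizer of a sum over sources, whereas the gain is built from
  stacked matrices. The two meet because the weight matrix is block diagonal, which turns the sum
  into one quadratic form of the stacked residual. Weights may vanish, so that form is in general
  only semidefinite; strict convexity, and with it uniqueness of the minimizer, comes from the
  inverse of \<open>Sig\<close>.\<close>

lemma mult_mat_zero_vec:
  assumes "(M :: real mat) \<in> carrier_mat n d"
  shows "M *\<^sub>v 0\<^sub>v d = 0\<^sub>v n"
  using assms by (intro eq_vecI) auto

lemma transpose_smult_mat: "(a \<cdot>\<^sub>m M)\<^sup>T = a \<cdot>\<^sub>m M\<^sup>T"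
  by (intro eq_matI) auto

text \<open>Bridge to \<open>L2_set\<close>, from which definiteness, the triangle inequality and
  Cauchy-Schwarz are inherited.\<close>

lemma vnorm_eq_L2_set: "vnorm v = L2_set (\<lambda>i. v $ i) {0..<dim_vec v}"
  by (simp add: vnorm_def L2_set_def scalar_prod_def power2_eq_square)

lemma vnorm_ge_0 [simp]: "vnorm v \<ge> 0"
  by (simp add: vnorm_eq_L2_set)

lemma vnorm_zero [simp]: "vnorm (0\<^sub>v n) = 0"
  by (simp add: vnorm_def)

lemma vnorm_eq_0_iff:
  assumes v: "v \<in> carrier_vec n"
  shows "vnorm v = 0 \<longleftrightarrow> v = 0\<^sub>v n"
proof -
  have "vnorm v = 0 \<longleftrightarrow> (\<forall>i\<in>{0..<n}. v $ i = 0)"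
    using v by (simp add: vnorm_eq_L2_set L2_set_eq_0_iff)
  also have "\<dots> \<longleftrightarrow> v = 0\<^sub>v n"
    using v by (auto simp: vec_eq_iff)
  finally show ?thesis .
qed

lemma vnorm_triangle:
  assumes "v \<in> carrier_vec n" "u \<in> carrier_vec n"
  shows "vnorm (v + u) \<le> vnorm v + vnorm u"
proof -
  have "vnorm (v + u) = L2_set (\<lambda>i. v $ i + u $ i) {0..<n}"
    using assms by (auto simp: vnorm_eq_L2_set intro!: L2_set_cong)
  also have "\<dots> \<le> vnorm v + vnorm u"
    using assms L2_set_triangle_ineq[of "\<lambda>i. v $ i" "\<lambda>i. u $ i" "{0..<n}"]
    by (simp add: vnorm_eq_L2_set)
  finally show ?thesis .
qed

lemma vnorm_smult: "vnorm (a \<cdot>\<^sub>v v) = \<bar>a\<bar> * vnorm v"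
proof -
  have "(a \<cdot>\<^sub>v v) \<bullet> (a \<cdot>\<^sub>v v) = a\<^sup>2 * (v \<bullet> v)"
    by (simp add: power2_eq_square)
  then show ?thesis
    by (simp add: vnorm_def real_sqrt_mult)
qed

text \<open>Cauchy-Schwarz. The absolute value is moved inside the sum first, to match the form of
  \<open>L2_set_mult_ineq\<close>.\<close>

lemma abs_scalar_prod_le:
  assumes "dim_vec u = dim_vec v"
  shows "\<bar>u \<bullet> v\<bar> \<le> vnorm u * vnorm v"
proof -
  have "\<bar>u \<bullet> v\<bar> \<le> (\<Sum>i\<in>{0..<dim_vec v}. \<bar>u $ i\<bar> * \<bar>v $ i\<bar>)"
    by (auto simp: scalar_prod_def abs_mult intro: order_trans[OF sum_abs])
  also have "\<dots> \<le> vnorm u * vnorm v"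
    using L2_set_mult_ineq[of "\<lambda>i. u $ i" "\<lambda>i. v $ i" "{0..<dim_vec v}"] assms
    by (simp add: vnorm_eq_L2_set)
  finally show ?thesis .
qed

text \<open>A real \<open>Sup\<close> bounds the elements of a set only if the set is bounded above.
  Here Cauchy-Schwarz in each row gives the crude bound by the sum of the row norms.\<close>

lemma bdd_above_spectral:
  "bdd_above {vnorm (M *\<^sub>v v) | v. v \<in> carrier_vec (dim_col M) \<and> vnorm v \<le> 1}"
proof (rule bdd_aboveI, clarify)
  fix v :: "real vec"
  assume v: "v \<in> carrier_vec (dim_col M)" "vnorm v \<le> 1"
  have "vnorm (M *\<^sub>v v) \<le> (\<Sum>i\<in>{0..<dim_row M}. \<bar>row M i \<bullet> v\<bar>)"
    using L2_set_le_sum_abs[of "\<lambda>i. (M *\<^sub>v v) $ i" "{0..<dim_row M}"]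
    by (simp add: vnorm_eq_L2_set)
  also have "\<dots> \<le> (\<Sum>i\<in>{0..<dim_row M}. vnorm (row M i))"
  proof (rule sum_mono)
    fix i
    have "\<bar>row M i \<bullet> v\<bar> \<le> vnorm (row M i) * vnorm v"
      using v by (intro abs_scalar_prod_le) auto
    also have "\<dots> \<le> vnorm (row M i)"
      using v by (simp add: mult_left_le)
    finally show "\<bar>row M i \<bullet> v\<bar> \<le> vnorm (row M i)" .
  qed
  finally show "vnorm (M *\<^sub>v v) \<le> (\<Sum>i\<in>{0..<dim_row M}. vnorm (row M i))" .
qed

text \<open>By homogeneity it suffices to look at the normalized vector, which is one of the
  competitors in the supremum. The zero vector cannot be normalized and is treated
  separately.\<close>

lemma vnorm_mult_mat_vec_le:
  assumes M: "M \<in> carrier_mat n d" and v: "v \<in> carrier_vec d"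
  shows "vnorm (M *\<^sub>v v) \<le> spectral_norm M * vnorm v"
proof (cases "vnorm v = 0")
  case True
  then have "v = 0\<^sub>v d"
    using vnorm_eq_0_iff[OF v] by simp
  moreover have "M *\<^sub>v 0\<^sub>v d = 0\<^sub>v n"
    using M by (rule mult_mat_zero_vec)
  ultimately show ?thesis
    by simp
next
  case False
  then have pos: "vnorm v > 0"
    by (simp add: less_le)
  let ?u = "(1 / vnorm v) \<cdot>\<^sub>v v"
  have "vnorm ?u \<le> 1"
    using pos by (simp add: vnorm_smult)
  then have "vnorm (M *\<^sub>v ?u) \<le> spectral_norm M"
    unfolding spectral_norm_def using M v by (intro cSup_upper bdd_above_spectral) auto
  moreover have "M *\<^sub>v ?u = (1 / vnorm v) \<cdot>\<^sub>v (M *\<^sub>v v)"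
    using M v by (rule mult_mat_vec)
  ultimately show ?thesis
    using pos by (simp add: vnorm_smult divide_simps)
qed

section \<open>Positive definite matrices\<close>

lemma scalar_prod_symmetric_mat:
  fixes M :: "real mat"
  assumes M: "M \<in> carrier_mat n n" "M\<^sup>T = M" and u: "u \<in> carrier_vec n" and v: "v \<in> carrier_vec n"
  shows "u \<bullet> (M *\<^sub>v v) = v \<bullet> (M *\<^sub>v u)"
proof -
  have "u \<bullet> (M *\<^sub>v v) = (M *\<^sub>v u) \<bullet> v"
    using transpose_vec_mult_scalar[OF M(1) v u] M(2) by simp
  also have "\<dots> = v \<bullet> (M *\<^sub>v u)"
    using M(1) u v by (intro comm_scalar_prod[of _ n]) auto
  finally show ?thesis .
qed

text \<open>Symmetry of \<open>M\<close> makes the two cross terms equal, hence the factor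
  2.\<close>

lemma wnorm_sq_diff:
  assumes M: "M \<in> carrier_mat n n" "M\<^sup>T = M" and u: "u \<in> carrier_vec n" and v: "v \<in> carrier_vec n"
  shows "wnorm_sq M (u - v) = wnorm_sq M u - 2 * (u \<bullet> (M *\<^sub>v v)) + wnorm_sq M v"
proof -
  have Mu: "M *\<^sub>v u \<in> carrier_vec n" and Mv: "M *\<^sub>v v \<in> carrier_vec n"
    using M(1) u v by auto
  have "wnorm_sq M (u - v) = (u - v) \<bullet> (M *\<^sub>v u - M *\<^sub>v v)"
    by (simp add: wnorm_sq_def mult_minus_distrib_mat_vec[OF M(1) u v])
  also have "\<dots> = u \<bullet> (M *\<^sub>v u) - v \<bullet> (M *\<^sub>v u) - (u \<bullet> (M *\<^sub>v v) - v \<bullet> (M *\<^sub>v v))"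
    using u v Mu Mv by (simp add: scalar_prod_minus_distrib[of _ n] minus_scalar_prod_distrib[of _ n])
  finally show ?thesis
    using scalar_prod_symmetric_mat[OF M u v] by (simp add: wnorm_sq_def)
qed

text \<open>A nonzero kernel vector would make the quadratic form vanish, so the determinant is
  nonzero. Hence \<open>mat_inverse\<close> succeeds and \<open>inv_mat\<close> is a genuine
  two-sided inverse.\<close>

lemma pos_def_mat_inv:
  assumes "pos_def_mat n M"
  shows "inv_mat M \<in> carrier_mat n n" "M * inv_mat M = 1\<^sub>m n" "inv_mat M * M = 1\<^sub>m n"
proof -
  have M: "M \<in> carrier_mat n n"
    and pos: "\<And>v. v \<in> carrier_vec n \<Longrightarrow> v \<noteq> 0\<^sub>v n \<Longrightarrow> v \<bullet> (M *\<^sub>v v) > 0"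
    using assms by (auto simp: pos_def_mat_def)
  have "det M \<noteq> 0"
  proof
    assume "det M = 0"
    then obtain v where v: "v \<in> carrier_vec n" "v \<noteq> 0\<^sub>v n" "M *\<^sub>v v = 0\<^sub>v n"
      using det_0_iff_vec_prod_zero[OF M] by auto
    show False
      using pos[OF v(1,2)] v by simp
  qed
  then have "M \<in> Units (ring_mat TYPE(real) n ())"
    using M by (intro det_non_zero_imp_unit)
  then obtain B where "mat_inverse M = Some B"
    using mat_inverse(1)[OF M, of "()"] by (cases "mat_inverse M") auto
  then show "inv_mat M \<in> carrier_mat n n" "M * inv_mat M = 1\<^sub>m n" "inv_mat M * M = 1\<^sub>m n"
    using mat_inverse(2)[OF M] by (auto simp: inv_mat_def)
qed

text \<open>The substitution \<open>v = M u\<close> with \<open>u = inv_mat M v\<close> turns the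
  form of the inverse at \<open>v\<close> into the form of \<open>M\<close> at \<open>u\<close>, and
  \<open>u\<close> is nonzero when \<open>v\<close> is.\<close>

lemma pos_def_mat_inv_mat:
  assumes "pos_def_mat n M"
  shows "pos_def_mat n (inv_mat M)"
proof -
  let ?B = "inv_mat M"
  note B = pos_def_mat_inv[OF assms]
  have M: "M \<in> carrier_mat n n" "M\<^sup>T = M"
    and pos: "\<And>v. v \<in> carrier_vec n \<Longrightarrow> v \<noteq> 0\<^sub>v n \<Longrightarrow> v \<bullet> (M *\<^sub>v v) > 0"
    using assms by (auto simp: pos_def_mat_def)
  have BT: "?B\<^sup>T \<in> carrier_mat n n"
    using B(1) by simp
  \<comment> \<open>Transposing \<open>M * ?B = 1\<close> shows that the transpose of
    \<open>?B\<close> is a left inverse of \<open>M\<close>; it must agree with the right inverse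
    \<open>?B\<close>.\<close>
  have "?B\<^sup>T * M = 1\<^sub>m n"
    using transpose_mult[OF M(1) B(1)] M(2) B(2) by simp
  then have "?B\<^sup>T = ?B\<^sup>T * (M * ?B)" and "?B\<^sup>T * (M * ?B) = ?B"
    using B BT M(1) assoc_mult_mat[OF BT M(1) B(1)] by auto
  then have sym: "?B\<^sup>T = ?B"
    by simp
  have "v \<bullet> (?B *\<^sub>v v) > 0" if v: "v \<in> carrier_vec n" "v \<noteq> 0\<^sub>v n" for v
  proof -
    have Bv: "?B *\<^sub>v v \<in> carrier_vec n"
      using B(1) v(1) by auto
    have MBv: "M *\<^sub>v (?B *\<^sub>v v) = v"
      using assoc_mult_mat_vec[OF M(1) B(1) v(1)] B(2) v(1) by simp
    have "?B *\<^sub>v v \<noteq> 0\<^sub>v n"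
      using MBv mult_mat_zero_vec[OF M(1)] v(2) by auto
    from pos[OF Bv this] show ?thesis
      using MBv comm_scalar_prod[OF v(1) Bv] by simp
  qed
  with B(1) sym show ?thesis
    by (simp add: pos_def_mat_def)
qed

text \<open>\<open>W\<close> is required to be nonnegative only on the range of \<open>H\<close>: in
  the application these vectors are stackings, on which the form of \<open>W\<close> splits by
  source. The second claim is the bilinear identity that \<open>complete_square\<close> takes as
  \<open>form\<close>.\<close>

lemma pos_def_mat_congruence:
  fixes P W H :: "real mat"
  assumes P: "pos_def_mat d P" and W: "W \<in> carrier_mat n n" "W\<^sup>T = W"
    and psd: "\<And>u. u \<in> carrier_vec d \<Longrightarrow> wnorm_sq W (H *\<^sub>v u) \<ge> 0" and H: "H \<in> carrier_mat n d"
  shows "pos_def_mat d (P + H\<^sup>T * W * H)"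
    and "u \<in> carrier_vec d \<Longrightarrow> v \<in> carrier_vec d \<Longrightarrow>
      u \<bullet> ((P + H\<^sup>T * W * H) *\<^sub>v v) = u \<bullet> (P *\<^sub>v v) + (H *\<^sub>v u) \<bullet> (W *\<^sub>v (H *\<^sub>v v))"
proof -
  have Pc: "P \<in> carrier_mat d d" "P\<^sup>T = P"
    using P by (auto simp: pos_def_mat_def)
  have HT: "H\<^sup>T \<in> carrier_mat d n"
    using H by simp
  have HTW: "H\<^sup>T * W \<in> carrier_mat d n"
    using HT W by simp
  have HWH: "H\<^sup>T * W * H \<in> carrier_mat d d"
    using HTW H by simp
  have "(H\<^sup>T * W * H)\<^sup>T = H\<^sup>T * (H\<^sup>T * W)\<^sup>T"
    using transpose_mult[OF HTW H] .
  also have "(H\<^sup>T * W)\<^sup>T = W * H"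
    using transpose_mult[OF HT W(1)] W(2) by simp
  also have "H\<^sup>T * (W * H) = H\<^sup>T * W * H"
    using assoc_mult_mat[OF HT W(1) H] by simp
  finally have sym: "(P + H\<^sup>T * W * H)\<^sup>T = P + H\<^sup>T * W * H"
    using transpose_add[OF Pc(1) HWH] Pc(2) by simp
  have form: "u \<bullet> ((P + H\<^sup>T * W * H) *\<^sub>v v) = u \<bullet> (P *\<^sub>v v) + (H *\<^sub>v u) \<bullet> (W *\<^sub>v (H *\<^sub>v v))"
    if u: "u \<in> carrier_vec d" and v: "v \<in> carrier_vec d" for u v :: "real vec"
  proof -
    have Hv: "H *\<^sub>v v \<in> carrier_vec n" and Hu: "H *\<^sub>v u \<in> carrier_vec n"
      using H u v by auto
    have WHv: "W *\<^sub>v (H *\<^sub>v v) \<in> carrier_vec n"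
      using W(1) Hv by auto
    have "(H\<^sup>T * W * H) *\<^sub>v v = H\<^sup>T *\<^sub>v (W *\<^sub>v (H *\<^sub>v v))"
      using assoc_mult_mat_vec[OF HTW H v] assoc_mult_mat_vec[OF HT W(1) Hv] by simp
    moreover have "u \<bullet> (H\<^sup>T *\<^sub>v (W *\<^sub>v (H *\<^sub>v v))) = (H *\<^sub>v u) \<bullet> (W *\<^sub>v (H *\<^sub>v v))"
      using transpose_vec_mult_scalar[OF H u WHv] comm_scalar_prod[OF Hu WHv]
        comm_scalar_prod[OF u mult_mat_vec_carrier[OF HT WHv]] by simp
    moreover have "(P + H\<^sup>T * W * H) *\<^sub>v v = P *\<^sub>v v + (H\<^sup>T * W * H) *\<^sub>v v"
      using Pc(1) HWH v by (rule add_mult_distrib_mat_vec)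
    moreover have "u \<bullet> (P *\<^sub>v v + (H\<^sup>T * W * H) *\<^sub>v v) = u \<bullet> (P *\<^sub>v v) + u \<bullet> ((H\<^sup>T * W * H) *\<^sub>v v)"
      using Pc(1) HWH u v by (intro scalar_prod_add_distrib[of _ d]) auto
    ultimately show ?thesis
      by simp
  qed
  then show "u \<in> carrier_vec d \<Longrightarrow> v \<in> carrier_vec d \<Longrightarrow>
      u \<bullet> ((P + H\<^sup>T * W * H) *\<^sub>v v) = u \<bullet> (P *\<^sub>v v) + (H *\<^sub>v u) \<bullet> (W *\<^sub>v (H *\<^sub>v v))" .
  show "pos_def_mat d (P + H\<^sup>T * W * H)"
    unfolding pos_def_mat_def
  proof (intro conjI ballI impI)
    fix v :: "real vec"
    assume v: "v \<in> carrier_vec d" "v \<noteq> 0\<^sub>v d"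
    have "v \<bullet> (P *\<^sub>v v) > 0"
      using P v by (auto simp: pos_def_mat_def)
    moreover have "(H *\<^sub>v v) \<bullet> (W *\<^sub>v (H *\<^sub>v v)) \<ge> 0"
      using psd[OF v(1)] by (simp add: wnorm_sq_def)
    ultimately show "v \<bullet> ((P + H\<^sup>T * W * H) *\<^sub>v v) > 0"
      using form[OF v(1) v(1)] by simp
  qed (use Pc HWH sym in auto)
qed

text \<open>By \<open>form\<close> the parts quadratic in \<open>e\<close> agree on both sides. The
  normal equation \<open>stationary\<close> matches the linear parts, and the last bracket collects
  what does not depend on \<open>e\<close>.\<close>

lemma complete_square:
  assumes P: "P \<in> carrier_mat d d" "P\<^sup>T = P"
    and W: "W \<in> carrier_mat n n" "W\<^sup>T = W"
    and H: "H \<in> carrier_mat n d"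
    and M: "M \<in> carrier_mat d d" "M\<^sup>T = M"
    and form: "\<And>u v. u \<in> carrier_vec d \<Longrightarrow> v \<in> carrier_vec d \<Longrightarrow>
      u \<bullet> (M *\<^sub>v v) = u \<bullet> (P *\<^sub>v v) + (H *\<^sub>v u) \<bullet> (W *\<^sub>v (H *\<^sub>v v))"
    and e: "e \<in> carrier_vec d" and b: "b \<in> carrier_vec d" and r: "r \<in> carrier_vec n"
    and stationary: "M *\<^sub>v b = H\<^sup>T *\<^sub>v (W *\<^sub>v r)"
  shows "wnorm_sq P e + wnorm_sq W (r - H *\<^sub>v e)
    = wnorm_sq M (e - b) + (wnorm_sq W r - wnorm_sq M b)"
proof -
  have He: "H *\<^sub>v e \<in> carrier_vec n" and Wr: "W *\<^sub>v r \<in> carrier_vec n"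
    using H W e r by auto
  \<comment> \<open>The only term linear in \<open>e\<close> on the left; it is rewritten until the
    normal equation applies.\<close>
  have "r \<bullet> (W *\<^sub>v (H *\<^sub>v e)) = (H *\<^sub>v e) \<bullet> (W *\<^sub>v r)"
    using scalar_prod_symmetric_mat[OF W r He] .
  also have "\<dots> = (W *\<^sub>v r) \<bullet> (H *\<^sub>v e)"
    using comm_scalar_prod[OF He Wr] .
  also have "\<dots> = (H\<^sup>T *\<^sub>v (W *\<^sub>v r)) \<bullet> e"
    using transpose_vec_mult_scalar[OF H e Wr] by simp
  also have "\<dots> = (M *\<^sub>v b) \<bullet> e"
    by (simp add: stationary)
  also have "\<dots> = e \<bullet> (M *\<^sub>v b)"
    using M(1) e b by (intro comm_scalar_prod[of _ d]) auto
  finally show ?thesis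
    using wnorm_sq_diff[OF W r He] wnorm_sq_diff[OF M e b] form[OF e e]
    by (simp add: wnorm_sq_def)
qed

section \<open>Stacked observations\<close>

lemma append_vec_diff:
  fixes u u' v v' :: "'a :: ring vec"
  assumes "u \<in> carrier_vec n" "u' \<in> carrier_vec n" "v \<in> carrier_vec k" "v' \<in> carrier_vec k"
  shows "(u @\<^sub>v v) - (u' @\<^sub>v v') = (u - u') @\<^sub>v (v - v')"
  using assms by (intro eq_vecI) auto

lemma stack_vec_carrier:
  assumes "finite J" "\<And>i. i \<in> J \<Longrightarrow> y i \<in> carrier_vec (m i)"
  shows "stack_vec y J \<in> carrier_vec (sum_list (map m (sorted_list_of_set J)))"
proof -
  \<comment> \<open>Stated for an arbitrary list so that induction applies, then specialized to the
    sorted list of \<open>J\<close>; the other stacking lemmas follow the same pattern.\<close>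
  have "foldr (\<lambda>i v. y i @\<^sub>v v) js (0\<^sub>v 0) \<in> carrier_vec (sum_list (map m js))"
    if "\<And>i. i \<in> set js \<Longrightarrow> y i \<in> carrier_vec (m i)" for js
    using that by (induction js) auto
  from this[of "sorted_list_of_set J"] show ?thesis
    using assms by (simp add: stack_vec_def)
qed

lemma stack_vec_diff:
  assumes "finite J" "\<And>i. i \<in> J \<Longrightarrow> y i \<in> carrier_vec (m i)"
    "\<And>i. i \<in> J \<Longrightarrow> z i \<in> carrier_vec (m i)"
  shows "stack_vec y J - stack_vec z J = stack_vec (\<lambda>i. y i - z i) J"
proof -
  let ?st = "\<lambda>y js. foldr (\<lambda>i v. y i @\<^sub>v v) js (0\<^sub>v 0 :: real vec)"
  \<comment> \<open>The dimensions belong to the induction claim because the block operations in the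
    step need those of the tail.\<close>
  have "?st y js \<in> carrier_vec (sum_list (map m js))
      \<and> ?st z js \<in> carrier_vec (sum_list (map m js))
      \<and> ?st y js - ?st z js = ?st (\<lambda>i. y i - z i) js"
    if "\<And>i. i \<in> set js \<Longrightarrow> y i \<in> carrier_vec (m i) \<and> z i \<in> carrier_vec (m i)" for js
    using that
  proof (induction js)
    case (Cons i js)
    then have "?st y js \<in> carrier_vec (sum_list (map m js))"
      "?st z js \<in> carrier_vec (sum_list (map m js))"
      "?st y js - ?st z js = ?st (\<lambda>i. y i - z i) js"
      "y i \<in> carrier_vec (m i)" "z i \<in> carrier_vec (m i)"
      by auto
    then show ?case
      by (auto simp: append_vec_diff[of _ "m i" _ _ "sum_list (map m js)"])
  qed auto
  from this[of "sorted_list_of_set J"] show ?thesis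
    using assms by (simp add: stack_vec_def)
qed

lemma stack_mat_carrier:
  assumes "finite J" "\<And>i. i \<in> J \<Longrightarrow> H i \<in> carrier_mat (m i) d"
  shows "stack_mat d H J \<in> carrier_mat (sum_list (map m (sorted_list_of_set J))) d"
proof -
  have "foldr (\<lambda>i M. H i @\<^sub>r M) js (0\<^sub>m 0 d) \<in> carrier_mat (sum_list (map m js)) d"
    if "\<And>i. i \<in> set js \<Longrightarrow> H i \<in> carrier_mat (m i) d" for js
    using that by (induction js) auto
  from this[of "sorted_list_of_set J"] show ?thesis
    using assms by (simp add: stack_mat_def)
qed

lemma stack_mat_mult_vec:
  assumes "finite J" "\<And>i. i \<in> J \<Longrightarrow> H i \<in> carrier_mat (m i) d" and z: "z \<in> carrier_vec d"
  shows "stack_mat d H J *\<^sub>v z = stack_vec (\<lambda>i. H i *\<^sub>v z) J"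
proof -
  let ?st = "\<lambda>js. foldr (\<lambda>i M. H i @\<^sub>r M) js (0\<^sub>m 0 d)"
  have "?st js \<in> carrier_mat (sum_list (map m js)) d
      \<and> ?st js *\<^sub>v z = foldr (\<lambda>i v. (H i *\<^sub>v z) @\<^sub>v v) js (0\<^sub>v 0)"
    if "\<And>i. i \<in> set js \<Longrightarrow> H i \<in> carrier_mat (m i) d" for js
    using that
  proof (induction js)
    case (Cons i js)
    then have IH: "?st js \<in> carrier_mat (sum_list (map m js)) d"
      "?st js *\<^sub>v z = foldr (\<lambda>i v. (H i *\<^sub>v z) @\<^sub>v v) js (0\<^sub>v 0)"
      and Hi: "H i \<in> carrier_mat (m i) d"
      by auto
    then show ?case
      using mat_mult_append[OF Hi IH(1) z] by auto
  next
    case Nil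
    show ?case
      by auto
  qed
  from this[of "sorted_list_of_set J"] show ?thesis
    using assms by (simp add: stack_mat_def stack_vec_def)
qed

lemma weight_mat_symmetric:
  assumes "finite J" "\<And>i. i \<in> J \<Longrightarrow> pos_def_mat (m i) (R i)"
  defines "n \<equiv> sum_list (map m (sorted_list_of_set J))"
  shows "weight_mat R \<omega> J \<in> carrier_mat n n" "(weight_mat R \<omega> J)\<^sup>T = weight_mat R \<omega> J"
proof -
  let ?W = "\<lambda>js. diag_block_mat (map (\<lambda>i. \<omega> i \<cdot>\<^sub>m inv_mat (R i)) js)"
  have "?W js \<in> carrier_mat (sum_list (map m js)) (sum_list (map m js)) \<and> (?W js)\<^sup>T = ?W js"
    if "\<And>i. i \<in> set js \<Longrightarrow> pos_def_mat (m i) (R i)" for js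
    using that
  proof (induction js)
    case (Cons i js)
    let ?k = "sum_list (map m js)"
    have IH: "?W js \<in> carrier_mat ?k ?k" "(?W js)\<^sup>T = ?W js"
      and "pos_def_mat (m i) (inv_mat (R i))"
      using Cons by (auto intro: pos_def_mat_inv_mat)
    then have B: "inv_mat (R i) \<in> carrier_mat (m i) (m i)" "(inv_mat (R i))\<^sup>T = inv_mat (R i)"
      by (auto simp: pos_def_mat_def)
    then have Ri: "\<omega> i \<cdot>\<^sub>m inv_mat (R i) \<in> carrier_mat (m i) (m i)"
      "(\<omega> i \<cdot>\<^sub>m inv_mat (R i))\<^sup>T = \<omega> i \<cdot>\<^sub>m inv_mat (R i)"
      by (simp_all add: transpose_smult_mat)
    have W: "?W (i # js) = four_block_mat (\<omega> i \<cdot>\<^sub>m inv_mat (R i)) (0\<^sub>m (m i) ?k) (0\<^sub>m ?k (m i)) (?W js)"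
      using IH B by (simp add: Let_def)
    then have "(?W (i # js))\<^sup>T = ?W (i # js)"
      using transpose_four_block_mat[OF Ri(1) zero_carrier_mat zero_carrier_mat IH(1)] IH(2) Ri(2)
      by simp
    moreover have "?W (i # js) \<in> carrier_mat (m i + ?k) (m i + ?k)"
      unfolding W using Ri(1) IH(1) by (rule four_block_carrier_mat)
    ultimately show ?case
      by simp
  qed auto
  from this[of "sorted_list_of_set J"]
  show "weight_mat R \<omega> J \<in> carrier_mat n n" "(weight_mat R \<omega> J)\<^sup>T = weight_mat R \<omega> J"
    using assms by (auto simp: weight_mat_def)
qed

text \<open>Off-diagonal blocks are zero, so no cross terms between sources arise. This identifies
  the measurement part of the cost with one stacked quadratic form.\<close>

lemma wnorm_sq_weight_mat:
  assumes J: "finite J" and R: "\<And>i. i \<in> J \<Longrightarrow> pos_def_mat (m i) (R i)"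
    and u: "\<And>i. i \<in> J \<Longrightarrow> u i \<in> carrier_vec (m i)"
  shows "wnorm_sq (weight_mat R \<omega> J) (stack_vec u J) = (\<Sum>i\<in>J. \<omega> i * wnorm_sq (inv_mat (R i)) (u i))"
proof -
  let ?W = "\<lambda>js. diag_block_mat (map (\<lambda>i. \<omega> i \<cdot>\<^sub>m inv_mat (R i)) js)"
  let ?st = "\<lambda>js. foldr (\<lambda>i v. u i @\<^sub>v v) js (0\<^sub>v 0)"
  have "?W js \<in> carrier_mat (sum_list (map m js)) (sum_list (map m js))
      \<and> ?st js \<in> carrier_vec (sum_list (map m js))
      \<and> wnorm_sq (?W js) (?st js) = (\<Sum>i\<leftarrow>js. \<omega> i * wnorm_sq (inv_mat (R i)) (u i))"
    if "\<And>i. i \<in> set js \<Longrightarrow> pos_def_mat (m i) (R i) \<and> u i \<in> carrier_vec (m i)" for js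
    using that
  proof (induction js)
    case (Cons i js)
    let ?k = "sum_list (map m js)" and ?B = "inv_mat (R i)"
    have IH: "?W js \<in> carrier_mat ?k ?k" "?st js \<in> carrier_vec ?k"
      "wnorm_sq (?W js) (?st js) = (\<Sum>i\<leftarrow>js. \<omega> i * wnorm_sq (inv_mat (R i)) (u i))"
      and ui: "u i \<in> carrier_vec (m i)" and B: "?B \<in> carrier_mat (m i) (m i)"
      using Cons pos_def_mat_inv(1) by auto
    have oB: "\<omega> i \<cdot>\<^sub>m ?B \<in> carrier_mat (m i) (m i)"
      using B by simp
    have W: "?W (i # js) = four_block_mat (\<omega> i \<cdot>\<^sub>m ?B) (0\<^sub>m (m i) ?k) (0\<^sub>m ?k (m i)) (?W js)"
      using IH B by (simp add: Let_def)
    have mult: "?W (i # js) *\<^sub>v (u i @\<^sub>v ?st js) = (\<omega> i \<cdot>\<^sub>v (?B *\<^sub>v u i)) @\<^sub>v (?W js *\<^sub>v ?st js)"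
    proof -
      have "(\<omega> i \<cdot>\<^sub>m ?B) *\<^sub>v u i = \<omega> i \<cdot>\<^sub>v (?B *\<^sub>v u i)"
        using B ui by (intro eq_vecI) auto
      moreover have "0\<^sub>m (m i) ?k *\<^sub>v ?st js = 0\<^sub>v (m i)" "0\<^sub>m ?k (m i) *\<^sub>v u i = 0\<^sub>v ?k"
        using ui IH by auto
      ultimately show ?thesis
        unfolding W four_block_mat_mult_vec[OF oB zero_carrier_mat zero_carrier_mat IH(1) ui IH(2)]
        using B ui IH by simp
    qed
    have "wnorm_sq (?W (i # js)) (?st (i # js))
        = u i \<bullet> (\<omega> i \<cdot>\<^sub>v (?B *\<^sub>v u i)) + ?st js \<bullet> (?W js *\<^sub>v ?st js)"
      using scalar_prod_append[of "u i" "m i" "?st js" ?k "\<omega> i \<cdot>\<^sub>v (?B *\<^sub>v u i)" "?W js *\<^sub>v ?st js"]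
        B ui IH mult by (simp add: wnorm_sq_def)
    also have "u i \<bullet> (\<omega> i \<cdot>\<^sub>v (?B *\<^sub>v u i)) = \<omega> i * wnorm_sq ?B (u i)"
      using B ui by (simp add: wnorm_sq_def)
    finally show ?case
      using IH B ui W by (auto simp: wnorm_sq_def)
  qed (auto simp: wnorm_sq_def scalar_prod_def)
  from this[of "sorted_list_of_set J"] show ?thesis
    \<comment> \<open>The sorted list has distinct entries, so its list sum is the sum over
      \<open>J\<close> and the stacking order disappears.\<close>
    using assms by (simp add: weight_mat_def stack_vec_def sum_list_distinct_conv_sum_set)
qed

section \<open>The error recursion\<close>

text \<open>\<open>arg_min_on\<close> is a choice among minimizers; strict minimality leaves only
  one candidate.\<close>

lemma arg_min_on_unique:
  fixes f :: "'a \<Rightarrow> real"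
  assumes "z \<in> D" "\<And>u. u \<in> D \<Longrightarrow> u \<noteq> z \<Longrightarrow> f z < f u"
  shows "arg_min_on f D = z"
  unfolding arg_min_on_def arg_min_def
proof (rule some_equality)
  show "is_arg_min f (\<lambda>u. u \<in> D) z"
    using assms by (fastforce simp: is_arg_min_def)
next
  fix u
  assume "is_arg_min f (\<lambda>u. u \<in> D) u"
  then show "u = z"
    using assms by (auto simp: is_arg_min_def)
qed

text \<open>A single correction at a fixed time. Messages are arbitrary vectors of the right
  dimension, which covers consistent and nuisance sources at once.\<close>

locale correction_step =
  fixes d :: nat and m :: "nat \<Rightarrow> nat" and Sig :: "real mat" and H R :: "nat \<Rightarrow> real mat"
    and \<omega> :: "nat \<Rightarrow> real" and J :: "nat set" and y :: "nat \<Rightarrow> real vec"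
  assumes Sig: "pos_def_mat d Sig"
    and J: "finite J"
    and H: "\<And>i. i \<in> J \<Longrightarrow> H i \<in> carrier_mat (m i) d"
    and R: "\<And>i. i \<in> J \<Longrightarrow> pos_def_mat (m i) (R i)"
    and \<omega>: "\<And>i. i \<in> J \<Longrightarrow> \<omega> i \<ge> 0"
    and y: "\<And>i. i \<in> J \<Longrightarrow> y i \<in> carrier_vec (m i)"
begin

abbreviation "n \<equiv> sum_list (map m (sorted_list_of_set J))"
abbreviation "HH \<equiv> stack_mat d H J"
abbreviation "W \<equiv> weight_mat R \<omega> J"
abbreviation "Y \<equiv> stack_vec y J"
abbreviation "M \<equiv> info_mat d Sig H R \<omega> J"
abbreviation "K \<equiv> gain_mat d Sig H R \<omega> J"

lemma HH: "HH \<in> carrier_mat n d"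
  using J H by (rule stack_mat_carrier)

lemma W: "W \<in> carrier_mat n n" "W\<^sup>T = W"
  using weight_mat_symmetric[OF J R] by auto

lemma Y: "Y \<in> carrier_vec n"
  using J y by (rule stack_vec_carrier)

lemma weight_mat_psd:
  assumes u: "u \<in> carrier_vec d"
  shows "wnorm_sq W (HH *\<^sub>v u) \<ge> 0"
proof -
  have Hu: "H i *\<^sub>v u \<in> carrier_vec (m i)" if "i \<in> J" for i
    using H[OF that] u by auto
  have "wnorm_sq (inv_mat (R i)) (H i *\<^sub>v u) \<ge> 0" if i: "i \<in> J" for i
  \<comment> \<open>Positive definiteness speaks of nonzero vectors only, but \<open>H i\<close> may
    annihilate \<open>u\<close>.\<close>
  proof (cases "H i *\<^sub>v u = 0\<^sub>v (m i)")
    case True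
    then show ?thesis
      using pos_def_mat_inv(1)[OF R[OF i]] by (auto simp: wnorm_sq_def)
  next
    case False
    then show ?thesis
      using pos_def_mat_inv_mat[OF R[OF i]] Hu[OF i]
      by (auto simp: wnorm_sq_def pos_def_mat_def intro: less_imp_le)
  qed
  then show ?thesis
    using wnorm_sq_weight_mat[OF J R Hu] stack_mat_mult_vec[OF J H u] \<omega>
    by (simp add: sum_nonneg)
qed

text \<open>Strictness comes from the inverse of \<open>Sig\<close>, so the claim survives vanishing
  weights and an empty \<open>J\<close>.\<close>

lemma info_mat_pos_def: "pos_def_mat d M"
  unfolding info_mat_def
  using pos_def_mat_inv_mat[OF Sig] W weight_mat_psd HH by (rule pos_def_mat_congruence(1))

lemma K: "K \<in> carrier_mat d n"
  unfolding gain_mat_def using pos_def_mat_inv(1)[OF info_mat_pos_def] W(1) HH by auto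

text \<open>Recentred at the prediction \<open>p\<close>: the residual at \<open>z\<close> is the
  innovation \<open>Y - HH p\<close> minus \<open>HH\<close> applied to the deviation
  \<open>z - p\<close>. This is the shape of \<open>complete_square\<close> with
  \<open>e = z - p\<close>.\<close>

lemma correction_cost_eq:
  assumes p: "p \<in> carrier_vec d" and z: "z \<in> carrier_vec d"
  shows "correction_cost Sig H R \<omega> J y p z
    = wnorm_sq (inv_mat Sig) (z - p) + wnorm_sq W ((Y - HH *\<^sub>v p) - HH *\<^sub>v (z - p))"
proof -
  have Hz: "H i *\<^sub>v z \<in> carrier_vec (m i)" if "i \<in> J" for i
    using H[OF that] z by auto
  have "HH *\<^sub>v p \<in> carrier_vec n" "HH *\<^sub>v z \<in> carrier_vec n"
    using HH p z by auto
  then have "(Y - HH *\<^sub>v p) - HH *\<^sub>v (z - p) = Y - HH *\<^sub>v z"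
    using Y by (simp add: mult_minus_distrib_mat_vec[OF HH z p]) (intro eq_vecI, auto)
  also have "\<dots> = stack_vec (\<lambda>i. y i - H i *\<^sub>v z) J"
    using stack_mat_mult_vec[OF J H z] stack_vec_diff[OF J y Hz] by simp
  finally have "wnorm_sq W ((Y - HH *\<^sub>v p) - HH *\<^sub>v (z - p))
      = (\<Sum>i\<in>J. \<omega> i * wnorm_sq (inv_mat (R i)) (y i - H i *\<^sub>v z))"
    using wnorm_sq_weight_mat[OF J R, where u = "\<lambda>i. y i - H i *\<^sub>v z"] y Hz by simp
  then show ?thesis
    by (simp add: correction_cost_def)
qed

lemma arg_min_correction_cost:
  assumes p: "p \<in> carrier_vec d"
  shows "arg_min_on (correction_cost Sig H R \<omega> J y p) (carrier_vec d)
    = p + K *\<^sub>v (Y - HH *\<^sub>v p)"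
proof (rule arg_min_on_unique)
  let ?r = "Y - HH *\<^sub>v p"
  let ?b = "K *\<^sub>v ?r"
  let ?z = "p + ?b"
  let ?P = "inv_mat Sig"
  have r: "?r \<in> carrier_vec n"
    using Y HH p by auto
  have b: "?b \<in> carrier_vec d"
    using K r by auto
  show z: "?z \<in> carrier_vec d"
    using p b by simp
  have P: "pos_def_mat d ?P" "?P \<in> carrier_mat d d" "?P\<^sup>T = ?P"
    using pos_def_mat_inv_mat[OF Sig] by (auto simp: pos_def_mat_def)
  have M: "M \<in> carrier_mat d d" "M\<^sup>T = M"
    using info_mat_pos_def by (auto simp: pos_def_mat_def)
  note I = pos_def_mat_inv[OF info_mat_pos_def]
  have HT: "HH\<^sup>T \<in> carrier_mat d n"
    using HH by simp
  have Wr: "W *\<^sub>v ?r \<in> carrier_vec n"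
    using W r by auto
  have HWr: "HH\<^sup>T *\<^sub>v (W *\<^sub>v ?r) \<in> carrier_vec d"
    using HT Wr by auto
  have IHT: "inv_mat M * HH\<^sup>T \<in> carrier_mat d n"
    using I(1) HT by simp
  have "?b = inv_mat M *\<^sub>v (HH\<^sup>T *\<^sub>v (W *\<^sub>v ?r))"
    unfolding gain_mat_def
    using assoc_mult_mat_vec[OF IHT W(1) r] assoc_mult_mat_vec[OF I(1) HT Wr] by simp
  \<comment> \<open>The normal equation: \<open>M\<close> cancels its inverse at the front of the
    gain.\<close>
  then have stationary: "M *\<^sub>v ?b = HH\<^sup>T *\<^sub>v (W *\<^sub>v ?r)"
    using assoc_mult_mat_vec[OF M(1) I(1) HWr] I(2) HWr by simp
  have form: "u \<bullet> (M *\<^sub>v v) = u \<bullet> (?P *\<^sub>v v) + (HH *\<^sub>v u) \<bullet> (W *\<^sub>v (HH *\<^sub>v v))"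
    if "u \<in> carrier_vec d" "v \<in> carrier_vec d" for u v
    unfolding info_mat_def using P(1) W weight_mat_psd HH that by (rule pos_def_mat_congruence(2))
  \<comment> \<open>Up to a constant independent of \<open>u\<close>, the cost is a positive
    definite form of the distance to \<open>?z\<close>.\<close>
  have cost: "correction_cost Sig H R \<omega> J y p u
      = wnorm_sq M (u - ?z) + (wnorm_sq W ?r - wnorm_sq M ?b)"
    if u: "u \<in> carrier_vec d" for u
  proof -
    have up: "u - p \<in> carrier_vec d"
      using u p by simp
    have "u - p - ?b = u - ?z"
      using u p b K by (intro eq_vecI) auto
    then show ?thesis
      using correction_cost_eq[OF p u]
        complete_square[OF P(2,3) W HH M form up b r stationary] by simp
  qed
  fix u :: "real vec"
  assume u: "u \<in> carrier_vec d" "u \<noteq> ?z"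
  have uz: "u - ?z \<in> carrier_vec d"
    using u z by simp
  have "u - ?z \<noteq> 0\<^sub>v d"
  proof
    assume eq: "u - ?z = 0\<^sub>v d"
    have "u = (u - ?z) + ?z"
      using u(1) z K by (intro eq_vecI) auto
    also have "\<dots> = ?z"
      unfolding eq using z by simp
    finally show False
      using u(2) by simp
  qed
  then have "wnorm_sq M (u - ?z) > 0"
    using info_mat_pos_def uz by (auto simp: wnorm_sq_def pos_def_mat_def)
  moreover have "?z - ?z = 0\<^sub>v d"
    using z by simp
  then have "wnorm_sq M (?z - ?z) = 0"
    using M(1) by (auto simp: wnorm_sq_def)
  ultimately show "correction_cost Sig H R \<omega> J y p ?z < correction_cost Sig H R \<omega> J y p u"
    using cost[OF u(1)] cost[OF z] by simp
qed

text \<open>The current state \<open>A x + w\<close> enters the forcing through the mismatch term.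
  Its part \<open>K HH w\<close> cancels the one in \<open>(1 - K HH) w\<close>, and its part
  \<open>K HH A x\<close> cancels the one produced by the error matrix.\<close>

lemma error_recursion:
  assumes A: "A \<in> carrier_mat d d"
    and h: "h \<in> carrier_vec d" and x: "x \<in> carrier_vec d" and w: "w \<in> carrier_vec d"
  shows "arg_min_on (correction_cost Sig H R \<omega> J y (A *\<^sub>v h)) (carrier_vec d) - (A *\<^sub>v x + w)
    = error_mat d A Sig H R \<omega> J *\<^sub>v (h - x) + forcing d Sig H R \<omega> J y (A *\<^sub>v x + w) w"
proof -
  let ?p = "A *\<^sub>v h" and ?q = "A *\<^sub>v x"
  let ?G = "1\<^sub>m d - K * HH"
  have p: "?p \<in> carrier_vec d" and q: "?q \<in> carrier_vec d"
    using A h x by auto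
  have KH: "K * HH \<in> carrier_mat d d"
    using K HH by simp
  have G: "?G *\<^sub>v u = u - K *\<^sub>v (HH *\<^sub>v u)" if "u \<in> carrier_vec d" for u
    using minus_mult_distrib_mat_vec[OF one_carrier_mat KH that] assoc_mult_mat_vec[OF K HH that] that
    by simp
  have GA: "error_mat d A Sig H R \<omega> J *\<^sub>v (h - x) = (?p - ?q) - K *\<^sub>v (HH *\<^sub>v (?p - ?q))"
  proof -
    have "error_mat d A Sig H R \<omega> J *\<^sub>v (h - x) = ?G *\<^sub>v (?p - ?q)"
      unfolding error_mat_def
      using assoc_mult_mat_vec[of ?G d d A d "h - x"] KH A h x
      by (simp add: mult_minus_distrib_mat_vec[OF A h x] minus_carrier_mat[OF KH])
    then show ?thesis
      using G p q by simp
  qed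
  \<comment> \<open>With the images under the gain named, the claim becomes a linear identity
    checked entrywise.\<close>
  define a b c k where "a = K *\<^sub>v Y" and "b = K *\<^sub>v (HH *\<^sub>v ?p)"
    and "c = K *\<^sub>v (HH *\<^sub>v ?q)" and "k = K *\<^sub>v (HH *\<^sub>v w)"
  have Hc: "HH *\<^sub>v ?p \<in> carrier_vec n" "HH *\<^sub>v ?q \<in> carrier_vec n" "HH *\<^sub>v w \<in> carrier_vec n"
    using HH p q w by auto
  have abck: "a \<in> carrier_vec d" "b \<in> carrier_vec d" "c \<in> carrier_vec d" "k \<in> carrier_vec d"
    unfolding a_def b_def c_def k_def using K Y Hc by auto
  have "K *\<^sub>v (HH *\<^sub>v (?p - ?q)) = b - c"
    unfolding b_def c_def mult_minus_distrib_mat_vec[OF HH p q]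
    using mult_minus_distrib_mat_vec[OF K Hc(1,2)] .
  moreover have "K *\<^sub>v (Y - HH *\<^sub>v ?p) = a - b"
    unfolding a_def b_def using mult_minus_distrib_mat_vec[OF K Y Hc(1)] .
  moreover have "K *\<^sub>v (Y - HH *\<^sub>v (?q + w)) = a - (c + k)"
    unfolding a_def c_def k_def mult_add_distrib_mat_vec[OF HH q w]
      mult_add_distrib_mat_vec[OF K Hc(2,3), symmetric]
    using Hc by (intro mult_minus_distrib_mat_vec[OF K Y]) simp
  moreover have "?G *\<^sub>v w = w - k"
    using G[OF w] by (simp add: k_def)
  ultimately show ?thesis
    unfolding arg_min_correction_cost[OF p] forcing_def GA
    using abck A w by (intro eq_vecI) auto
qed

lemma error_mat_carrier: "A \<in> carrier_mat d d \<Longrightarrow> error_mat d A Sig H R \<omega> J \<in> carrier_mat d d"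
  unfolding error_mat_def using minus_carrier_mat[OF mult_carrier_mat[OF K HH]]
  by (rule mult_carrier_mat)

lemma forcing_carrier:
  "x \<in> carrier_vec d \<Longrightarrow> w \<in> carrier_vec d \<Longrightarrow> forcing d Sig H R \<omega> J y x w \<in> carrier_vec d"
  unfolding forcing_def using K HH Y
  by (intro add_carrier_vec uminus_carrier_vec[THEN iffD2] mult_mat_vec_carrier[of _ d d]
    mult_mat_vec_carrier[of _ d n] minus_carrier_vec minus_carrier_mat mult_carrier_mat) auto

lemma arg_min_carrier:
  "p \<in> carrier_vec d \<Longrightarrow> arg_min_on (correction_cost Sig H R \<omega> J y p) (carrier_vec d) \<in> carrier_vec d"
  using arg_min_correction_cost[of p] K HH Y by auto

end

section \<open>Unrolling the recursion\<close>

text \<open>Serves to peel off the earliest factor of a transition product. \<open>B\<close> must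
  vary in the induction, since \<open>fold\<close> passes on \<open>F l * B\<close> as the new start
  value.\<close>

lemma fold_mult_mat:
  fixes F :: "'b \<Rightarrow> 'a :: semiring_1 mat"
  assumes "\<And>l. l \<in> set ls \<Longrightarrow> F l \<in> carrier_mat d d" "B \<in> carrier_mat d d"
  shows "fold (\<lambda>l M. F l * M) ls B \<in> carrier_mat d d
    \<and> fold (\<lambda>l M. F l * M) ls B = fold (\<lambda>l M. F l * M) ls (1\<^sub>m d) * B"
  using assms
proof (induction ls arbitrary: B)
  case (Cons l ls)
  have Fl: "F l \<in> carrier_mat d d"
    using Cons.prems(1) by simp
  then have FB: "F l * B \<in> carrier_mat d d"
    using Cons.prems(2) by simp
  have IH: "fold (\<lambda>l M. F l * M) ls X \<in> carrier_mat d d"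
    "fold (\<lambda>l M. F l * M) ls X = fold (\<lambda>l M. F l * M) ls (1\<^sub>m d) * X"
    if "X \<in> carrier_mat d d" for X
    using Cons.IH[of X] Cons.prems(1) that by auto
  have "fold (\<lambda>l M. F l * M) ls (F l * B) = fold (\<lambda>l M. F l * M) ls (1\<^sub>m d) * (F l * B)"
    using IH(2)[OF FB] .
  also have "\<dots> = fold (\<lambda>l M. F l * M) ls (1\<^sub>m d) * F l * B"
    using assoc_mult_mat[OF IH(1)[OF one_carrier_mat] Fl Cons.prems(2)] by simp
  also have "fold (\<lambda>l M. F l * M) ls (1\<^sub>m d) * F l = fold (\<lambda>l M. F l * M) ls (F l)"
    using IH(2)[OF Fl] by simp
  finally show ?case
    using IH(1)[OF FB] Fl by (simp add: right_mult_one_mat[OF Fl])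
qed simp

lemma transition_carrier:
  assumes "\<And>l. s \<le> l \<Longrightarrow> l \<le> t \<Longrightarrow> F l \<in> carrier_mat d d"
  shows "transition d F t s \<in> carrier_mat d d"
  unfolding transition_def using assms fold_mult_mat[of "[s..t]" F d "1\<^sub>m d"] by simp

text \<open>\<open>fold\<close> multiplies later matrices on the left, so the head \<open>s\<close>
  of the list is the rightmost factor.\<close>

lemma transition_rec_right:
  assumes "s \<le> t" "\<And>l. s \<le> l \<Longrightarrow> l \<le> t \<Longrightarrow> F l \<in> carrier_mat d d"
  shows "transition d F t s = transition d F t (s + 1) * F s"
  unfolding transition_def using assms fold_mult_mat[of "[s + 1..t]" F d "F s"]
  by (simp add: upto_rec1 right_mult_one_mat[of "F s" d d])

lemma vnorm_affine_recursion:
  assumes F: "\<And>l. s \<le> l \<Longrightarrow> l \<le> t \<Longrightarrow> F l \<in> carrier_mat d d"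
    and e: "\<And>l. s - 1 \<le> l \<Longrightarrow> l \<le> t \<Longrightarrow> e l \<in> carrier_vec d"
    and \<eta>: "\<And>l. s \<le> l \<Longrightarrow> l \<le> t \<Longrightarrow> \<eta> l \<in> carrier_vec d"
    and recursion: "\<And>l. s \<le> l \<Longrightarrow> l \<le> t \<Longrightarrow> e l = F l *\<^sub>v e (l - 1) + \<eta> l"
    and c: "c \<ge> 1"
    and stability: "\<And>k. s \<le> k \<Longrightarrow> k \<le> t \<Longrightarrow>
      spectral_norm (transition d F t k) \<le> c * \<rho> ^ nat (t - k + 1)"
    and st: "s \<le> t"
  shows "vnorm (e t) \<le> c * \<rho> ^ nat (t - s + 1) * vnorm (e (s - 1))
      + c * (\<Sum>l = s..t. \<rho> ^ nat (t - l) * vnorm (\<eta> l))"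
proof -
  let ?\<Phi> = "transition d F t"
  have \<Phi>: "?\<Phi> k \<in> carrier_mat d d" if "s \<le> k" for k
    using that F by (intro transition_carrier) auto
  have \<Phi>\<eta>: "vnorm (?\<Phi> (l + 1) *\<^sub>v \<eta> l) \<le> c * (\<rho> ^ nat (t - l) * vnorm (\<eta> l))"
    if l: "s \<le> l" "l \<le> t" for l
  proof (cases "l = t")
    case True
    then have "?\<Phi> (l + 1) *\<^sub>v \<eta> l = \<eta> l"
      using \<eta> l by (simp add: transition_def)
    then show ?thesis
      using True c mult_right_mono[OF c, of "vnorm (\<eta> l)"] by simp
  next
    case False
    have "vnorm (?\<Phi> (l + 1) *\<^sub>v \<eta> l) \<le> spectral_norm (?\<Phi> (l + 1)) * vnorm (\<eta> l)"
      using \<Phi> \<eta> l by (intro vnorm_mult_mat_vec_le[of _ d d]) auto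
    \<comment> \<open>The product from \<open>l + 1\<close> to \<open>t\<close> has
      \<open>t - l\<close> factors, one fewer than the product from \<open>l\<close>.\<close>
    also have "\<dots> \<le> c * \<rho> ^ nat (t - (l + 1) + 1) * vnorm (\<eta> l)"
      using False l by (intro mult_right_mono stability) auto
    finally show ?thesis
      by (simp add: mult.assoc)
  qed
  \<comment> \<open>The difference is the accumulated effect at time \<open>t\<close> of the inputs
    \<open>k..t\<close>. Induction runs downwards from \<open>k = t + 1\<close>, where the product
    is the identity, the difference is zero and the sum is empty.\<close>
  have *: "vnorm (e t - ?\<Phi> k *\<^sub>v e (k - 1)) \<le> c * (\<Sum>l = k..t. \<rho> ^ nat (t - l) * vnorm (\<eta> l))"
    if "k \<le> t + 1" "s \<le> k" for k
    using that
  proof (induction k rule: int_le_induct)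
    case base
    have "e t \<in> carrier_vec d"
      using e[of t] st by simp
    then show ?case
      by (simp add: transition_def)
  next
    case (step k)
    then have k: "s \<le> k - 1" "k - 1 \<le> t" "s \<le> k"
      by auto
    let ?F = "F (k - 1)" and ?e = "e (k - 1 - 1)" and ?g = "\<eta> (k - 1)"
    have Fk: "?F \<in> carrier_mat d d" and ek: "?e \<in> carrier_vec d" and gk: "?g \<in> carrier_vec d"
      and et: "e t \<in> carrier_vec d"
      using F e \<eta> k st by auto
    have Fek: "?F *\<^sub>v ?e \<in> carrier_vec d"
      using Fk ek by auto
    have \<Phi>k: "?\<Phi> k \<in> carrier_mat d d"
      using \<Phi> k by simp
    have "?\<Phi> (k - 1) = ?\<Phi> k * ?F"
      using transition_rec_right[OF k(2), of F d] F k by auto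
    then have "?\<Phi> (k - 1) *\<^sub>v ?e = ?\<Phi> k *\<^sub>v (?F *\<^sub>v ?e)"
      using assoc_mult_mat_vec[OF \<Phi>k Fk ek] by simp
    moreover have "?\<Phi> k *\<^sub>v e (k - 1) = ?\<Phi> k *\<^sub>v (?F *\<^sub>v ?e) + ?\<Phi> k *\<^sub>v ?g"
      using recursion[OF k(1,2)] mult_add_distrib_mat_vec[OF \<Phi>k Fek gk] by simp
    moreover have a: "?\<Phi> k *\<^sub>v (?F *\<^sub>v ?e) \<in> carrier_vec d" "?\<Phi> k *\<^sub>v ?g \<in> carrier_vec d"
      using \<Phi>k Fek gk by auto
    \<comment> \<open>Moving the reference time one step back exposes exactly one new input, already
      propagated to time \<open>t\<close>.\<close>
    ultimately have eq: "e t - ?\<Phi> (k - 1) *\<^sub>v ?e = (e t - ?\<Phi> k *\<^sub>v e (k - 1)) + ?\<Phi> k *\<^sub>v ?g"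
      using et by (intro eq_vecI) auto
    have "vnorm (e t - ?\<Phi> (k - 1) *\<^sub>v ?e) \<le> vnorm (e t - ?\<Phi> k *\<^sub>v e (k - 1)) + vnorm (?\<Phi> k *\<^sub>v ?g)"
      unfolding eq using et a \<Phi>k e k by (intro vnorm_triangle[of _ d]) auto
    also have "\<dots> \<le> c * (\<Sum>l = k..t. \<rho> ^ nat (t - l) * vnorm (\<eta> l))
        + c * (\<rho> ^ nat (t - (k - 1)) * vnorm ?g)"
      using step.IH k \<Phi>\<eta>[OF k(1,2)] by simp
    also have "\<dots> = c * (\<Sum>l = k - 1..t. \<rho> ^ nat (t - l) * vnorm (\<eta> l))"
    proof -
      have "{k - 1..t} = insert (k - 1) {k..t}"
        using k by auto
      then show ?thesis
        by (simp add: algebra_simps)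
    qed
    finally show ?case .
  qed
  have es: "e (s - 1) \<in> carrier_vec d" and et: "e t \<in> carrier_vec d"
    using e st by auto
  have \<Phi>e: "?\<Phi> s *\<^sub>v e (s - 1) \<in> carrier_vec d"
    using \<Phi>[of s] es by auto
  \<comment> \<open>Homogeneous response to the error at \<open>s - 1\<close> plus the accumulated
    inputs.\<close>
  have "e t = ?\<Phi> s *\<^sub>v e (s - 1) + (e t - ?\<Phi> s *\<^sub>v e (s - 1))"
    using et \<Phi>e \<Phi>[of s] by (intro eq_vecI) auto
  then have "vnorm (e t) \<le> vnorm (?\<Phi> s *\<^sub>v e (s - 1)) + vnorm (e t - ?\<Phi> s *\<^sub>v e (s - 1))"
    using vnorm_triangle[OF \<Phi>e, of "e t - ?\<Phi> s *\<^sub>v e (s - 1)"] et \<Phi>e by simp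
  also have "vnorm (?\<Phi> s *\<^sub>v e (s - 1)) \<le> spectral_norm (?\<Phi> s) * vnorm (e (s - 1))"
    using \<Phi>[of s] es by (intro vnorm_mult_mat_vec_le[of _ d d]) auto
  also have "\<dots> \<le> c * \<rho> ^ nat (t - s + 1) * vnorm (e (s - 1))"
    using st by (intro mult_right_mono stability) auto
  also note *[of s]
  finally show ?thesis
    using st by simp
qed

theorem theorem1:
  fixes d N :: nat and m :: "nat \<Rightarrow> nat"
    and A Sig :: "real mat" and H R :: "nat \<Rightarrow> real mat"
    and C S :: "nat set" and Act :: "int \<Rightarrow> nat set"
    and \<omega> :: "int \<Rightarrow> nat \<Rightarrow> real"
    and x w xpred xhat :: "int \<Rightarrow> real vec"
    and y v \<xi> :: "int \<Rightarrow> nat \<Rightarrow> real vec"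
    and T_sep :: int and \<omega>_C \<omega>_S c \<rho> :: real
    and F :: "int \<Rightarrow> real mat" and \<eta> :: "int \<Rightarrow> real vec"
  assumes A: "A \<in> carrier_mat d d"
    and Sig: "pos_def_mat d Sig"
    and H: "\<And>i. i \<in> {1..N} \<Longrightarrow> H i \<in> carrier_mat (m i) d"
    and R: "\<And>i. i \<in> {1..N} \<Longrightarrow> pos_def_mat (m i) (R i)"
    and C: "C \<subseteq> {1..N}"
    and S: "S = {1..N} - C"
    and Act: "\<And>t. t \<ge> 0 \<Longrightarrow> Act t \<subseteq> {1..N}"
    and weights: "\<And>t i. t \<ge> 0 \<Longrightarrow> i \<in> {1..N} \<Longrightarrow> \<omega> t i \<in> {0..1}"
    and state_init: "x (- 1) \<in> carrier_vec d"
    and disturbance: "\<And>t. t \<ge> - 1 \<Longrightarrow> w t \<in> carrier_vec d"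
    and state: "\<And>t. t \<ge> - 1 \<Longrightarrow> x (t + 1) = A *\<^sub>v x t + w t"
    and noise: "\<And>t i. t \<ge> 0 \<Longrightarrow> i \<in> C \<inter> Act t \<Longrightarrow> v t i \<in> carrier_vec (m i)"
    and consistent: "\<And>t i. t \<ge> 0 \<Longrightarrow> i \<in> C \<inter> Act t \<Longrightarrow> y t i = H i *\<^sub>v x t + v t i"
    and signal: "\<And>t j. t \<ge> 0 \<Longrightarrow> j \<in> S \<inter> Act t \<Longrightarrow> \<xi> t j \<in> carrier_vec (m j)"
    and nuisance: "\<And>t j. t \<ge> 0 \<Longrightarrow> j \<in> S \<inter> Act t \<Longrightarrow> y t j = \<xi> t j"
    and estimate_init: "xhat (- 1) \<in> carrier_vec d"
    and predict: "\<And>t. t \<ge> 0 \<Longrightarrow> xpred t = A *\<^sub>v xhat (t - 1)"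
    and correct: "\<And>t. t \<ge> 0 \<Longrightarrow>
      xhat t = arg_min_on (correction_cost Sig H R (\<omega> t) (Act t) (y t) (xpred t)) (carrier_vec d)"
    and F: "\<And>t. t \<ge> 0 \<Longrightarrow> F t = error_mat d A Sig H R (\<omega> t) (Act t)"
    and \<eta>: "\<And>t. t \<ge> 0 \<Longrightarrow> \<eta> t = forcing d Sig H R (\<omega> t) (Act t) (y t) (x t) (w (t - 1))"
    and T_sep: "T_sep \<ge> 0"
    and thresholds: "\<omega>_C > 0" "\<omega>_S \<ge> 0" "\<omega>_S < \<omega>_C"
    and separation_C: "\<And>t i. t \<ge> T_sep \<Longrightarrow> i \<in> C \<inter> Act t \<Longrightarrow> \<omega> t i \<ge> \<omega>_C"
    and separation_S: "\<And>t j. t \<ge> T_sep \<Longrightarrow> j \<in> S \<inter> Act t \<Longrightarrow> \<omega> t j \<le> \<omega>_S"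
    and constants: "c \<ge> 1" "0 < \<rho>" "\<rho> < 1"
    and stability: "\<And>t s. T_sep \<le> s \<Longrightarrow> s \<le> t \<Longrightarrow>
      spectral_norm (transition d F t s) \<le> c * \<rho> ^ nat (t - s + 1)"
  shows "\<forall>t s. T_sep \<le> s \<longrightarrow> s \<le> t \<longrightarrow>
    vnorm (xhat t - x t) \<le> c * \<rho> ^ nat (t - s + 1) * vnorm (xhat (s - 1) - x (s - 1))
      + c * (\<Sum>l = s..t. \<rho> ^ nat (t - l) * vnorm (\<eta> l))"
proof (intro allI impI)
  fix t s :: int
  assume s: "T_sep \<le> s" and st: "s \<le> t"
  have x_carrier: "x l \<in> carrier_vec d" if "l \<ge> - 1" for l
    using that
  proof (induction l rule: int_ge_induct)
    case (step l)
    then show ?case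
      using state[of l] disturbance[of l] A by auto
  qed (rule state_init)
  have correction: "correction_step d m Sig H R (\<omega> l) (Act l) (y l)" if l: "l \<ge> 0" for l
  proof
    fix i assume i: "i \<in> Act l"
    then have iN: "i \<in> {1..N}"
      using Act[OF l] by auto
    show "H i \<in> carrier_mat (m i) d" "pos_def_mat (m i) (R i)" "\<omega> l i \<ge> 0"
      using H R weights[OF l] iN by auto
    show "y l i \<in> carrier_vec (m i)"
    \<comment> \<open>\<open>C\<close> and \<open>S\<close> partition the sources, so every active
      message has the dimension of its source.\<close>
    proof (cases "i \<in> C")
      case True
      then have "i \<in> C \<inter> Act l"
        using i by simp
      from consistent[OF l this] noise[OF l this] show ?thesis
        using add_carrier_vec[OF mult_mat_vec_carrier[OF H[OF iN]]] x_carrier[of l] l by simp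
    next
      case False
      then have "i \<in> S \<inter> Act l"
        using i iN S by simp
      from nuisance[OF l this] signal[OF l this] show ?thesis
        by simp
    qed
  qed (use Sig Act[OF l] in \<open>auto intro: finite_subset\<close>)
  \<comment> \<open>That the chosen minimizer is a vector of dimension \<open>d\<close> rests on its
    explicit formula.\<close>
  have xhat_carrier: "xhat l \<in> carrier_vec d" if "l \<ge> - 1" for l
    using that
  proof (induction l rule: int_ge_induct)
    case (step l)
    then have l: "l + 1 \<ge> 0" and "A *\<^sub>v xhat l \<in> carrier_vec d"
      using A by auto
    then show ?case
      using correction_step.arg_min_carrier[OF correction[OF l]] correct[OF l] predict[OF l] by simp
  qed (rule estimate_init)
  have state': "x l = A *\<^sub>v x (l - 1) + w (l - 1)" if "l \<ge> 0" for l
    using state[of "l - 1"] that by simp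
  let ?e = "\<lambda>l. xhat l - x l"
  show "vnorm (xhat t - x t) \<le> c * \<rho> ^ nat (t - s + 1) * vnorm (xhat (s - 1) - x (s - 1))
      + c * (\<Sum>l = s..t. \<rho> ^ nat (t - l) * vnorm (\<eta> l))"
  proof (rule vnorm_affine_recursion[where e = ?e and F = F and d = d])
    fix l assume l: "s \<le> l" "l \<le> t"
    \<comment> \<open>Hence \<open>l - 1\<close> is at least \<open>-1\<close>, the time of the
      initial data; this value is reached when \<open>s = 0\<close>.\<close>
    then have l0: "l \<ge> 0"
      using s T_sep by simp
    interpret correction_step d m Sig H R "\<omega> l" "Act l" "y l"
      using correction[OF l0] .
    have c: "xhat (l - 1) \<in> carrier_vec d" "x (l - 1) \<in> carrier_vec d" "x l \<in> carrier_vec d"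
      "w (l - 1) \<in> carrier_vec d"
      using xhat_carrier[of "l - 1"] x_carrier[of "l - 1"] x_carrier[of l] disturbance[of "l - 1"] l0 by auto
    show "F l \<in> carrier_mat d d"
      unfolding F[OF l0] using A by (rule error_mat_carrier)
    show "\<eta> l \<in> carrier_vec d"
      unfolding \<eta>[OF l0] using c by (intro forcing_carrier)
    show "xhat l - x l = F l *\<^sub>v (xhat (l - 1) - x (l - 1)) + \<eta> l"
      using error_recursion[OF A c(1,2,4)] state'[OF l0]
      by (simp add: F[OF l0] \<eta>[OF l0] correct[OF l0] predict[OF l0])
  next
    fix l assume "s - 1 \<le> l"
    then show "xhat l - x l \<in> carrier_vec d"
      using x_carrier[of l] xhat_carrier[of l] s T_sep by simp
  next
    fix k assume "s \<le> k" "k \<le> t"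
    then show "spectral_norm (transition d F t k) \<le> c * \<rho> ^ nat (t - k + 1)"
      using stability s by simp
  qed (use constants st in auto)
qed

end
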